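(* Let $r$ and $n$ be integers such that $1 \le r \le n$ and $n \equiv 0 \pmod r$. For $k \ge 2$, if $F_1, F_2, \ldots, F_k$ are graphs on a common set of $n$ vertices, each of which consists of the vertex-disjoint union of $n/r$ copies of $K_r$, then \[ \gamma_{\rm sd}(F_1,F_2,\ldots,F_k) \le \begin{cases} \left( \dfrac{k}{2r} \right) n & \text{if } k \text{ is even}, \\[2mm] \left( \dfrac{r(k+1) - 2}{2r^2} \right) n & \text{if } k \text{ is odd}. \end{cases} \]
   Context: All graphs are finite and simple. Given graphs $F_1,\ldots,F_k$ (called factors; not necessarily edge-disjoint) with common vertex set $V$, a set $S \subseteq V$ is a simultaneous dominating set if for every $i$, $1 \le i \le k$, every vertex not in $S$ is adjacent in $F_i$ to some vertex of $S$. The simultaneous domination number $\gamma_{\rm sd}(F_1,\ldots,F_k)$ is the minimum cardinality of a simultaneous dominating set. *)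

theory Defs
  imports Complex_Main "HOL-Library.Disjoint_Sets" "Graph_Theory.Graph_Theory"
begin

text \<open>
  A finite simple graph is a \<^const>\<open>pair_graph\<close>: its arc set \<^const>\<open>parcs\<close> is an irreflexive symmetric
  relation, so an edge \<open>{u, v}\<close> is represented by the two arcs \<open>(u, v)\<close> and \<open>(v, u)\<close>.
  The \<open>k\<close> factors are \<open>F 1, \<dots>, F k\<close>; values of \<open>F\<close> at other indices are irrelevant.
\<close>

definition disjoint_union_of_complete :: "nat \<Rightarrow> nat \<Rightarrow> 'a pair_pre_digraph \<Rightarrow> bool" where
  "disjoint_union_of_complete m r G \<longleftrightarrow>
    (\<exists>H :: nat \<Rightarrow> 'a pair_pre_digraph.
      (\<forall>j<m. complete_digraph r (with_proj (H j))) \<and>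
      disjoint_family_on (\<lambda>j. pverts (H j)) {..<m} \<and>
      pverts G = (\<Union>j<m. pverts (H j)) \<and>
      parcs G = (\<Union>j<m. parcs (H j)))"

definition sim_dominating :: "'a set \<Rightarrow> nat \<Rightarrow> (nat \<Rightarrow> 'a pair_pre_digraph) \<Rightarrow> 'a set \<Rightarrow> bool" where
  "sim_dominating V k F S \<longleftrightarrow>
    S \<subseteq> V \<and> (\<forall>i\<in>{1..k}. \<forall>v\<in>V - S. \<exists>u\<in>S. (v, u) \<in> parcs (F i))"

text \<open>For finite \<open>V\<close> the minimum ranges over a finite set, which is nonempty as \<open>V\<close> dominates itself.\<close>

definition sim_dom_number :: "'a set \<Rightarrow> nat \<Rightarrow> (nat \<Rightarrow> 'a pair_pre_digraph) \<Rightarrow> nat" where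
  "sim_dom_number V k F = Min (card ` {S. sim_dominating V k F S})"

end

theory Submission
  imports Defs
begin

text \<open>
  A set is simultaneously dominating as soon as it meets every clique of every factor. The cliques
  of two factors are the two sides of an \<open>r\<close>-regular bipartite multigraph whose edges are the
  vertices in \<open>V\<close>; by Hall's theorem it splits into \<open>r\<close> perfect matchings, each of which is a set
  of \<open>n / r\<close> vertices meeting all cliques of both factors. Pairing the factors settles even \<open>k\<close>.
  For odd \<open>k\<close>, three factors are treated together: every clique of the third one meets some of the
  \<open>r\<close> matchings of the first two, so one of the matchings meets at least \<open>n / r\<^sup>2\<close> of them,
  and only the remaining ones require an extra vertex.
\<close>

section \<open>Hall's marriage theorem\<close>

theorem hall_marriage:
  fixes S :: "'i \<Rightarrow> 'b set"
  assumes "finite I" and "\<And>i. i \<in> I \<Longrightarrow> finite (S i)"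
    and "\<And>J. J \<subseteq> I \<Longrightarrow> card J \<le> card (\<Union>(S ` J))"
  shows "\<exists>R. inj_on R I \<and> (\<forall>i\<in>I. R i \<in> S i)"
  using assms
proof (induction "card I" arbitrary: I S rule: less_induct)
  case less
  note fin = less.prems(1) and finS = less.prems(2) and hall = less.prems(3)
  have finU: "finite (\<Union>(S ` J))" if "J \<subseteq> I" for J
    using that fin finS by (auto intro: finite_subset)
  \<comment> \<open>The Halmos-Vaughan case split: either every nonempty proper subfamily has an
    element to spare, or some such subfamily \<open>J\<close> is tight and is matched
    separately.\<close>
  consider "I = {}"
    | (slack) "I \<noteq> {}" "\<And>J. J \<subset> I \<Longrightarrow> J \<noteq> {} \<Longrightarrow> card J < card (\<Union>(S ` J))"
    | (tight) J where "J \<subset> I" "J \<noteq> {}" "card J = card (\<Union>(S ` J))"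
    using hall by (metis le_neq_implies_less psubset_imp_subset)
  then show ?case
  proof cases
    case 1
    then show ?thesis by simp
  next
    case slack
    then obtain i where i: "i \<in> I" by blast
    have "card {i} \<le> card (S i)" using hall[of "{i}"] i by simp
    then obtain x where x: "x \<in> S i" by fastforce
    have "\<exists>R. inj_on R (I - {i}) \<and> (\<forall>j\<in>I - {i}. R j \<in> S j - {x})"
    proof (rule less.hyps)
      show "card (I - {i}) < card I" using fin i by (rule card_Diff1_less)
      show "finite (I - {i})" using fin by simp
      show "finite (S j - {x})" if "j \<in> I - {i}" for j using that finS by simp
      fix J assume J: "J \<subseteq> I - {i}"
      show "card J \<le> card (\<Union>j\<in>J. S j - {x})"
      proof (cases "J = {}")
        case False
        \<comment> \<open>\<open>J\<close> omits \<open>i\<close>, so the strict inequality applies,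
          and it absorbs the loss of the single element \<open>x\<close>.\<close>
        have "J \<subset> I" using J i by blast
        then have "card J < card (\<Union>(S ` J))" using slack False by blast
        moreover have "(\<Union>j\<in>J. S j - {x}) = \<Union>(S ` J) - {x}" by blast
        moreover have "card (\<Union>(S ` J)) - 1 \<le> card (\<Union>(S ` J) - {x})"
          by (metis card_Diff1_le card_Diff_singleton_if diff_le_self order_refl)
        ultimately show ?thesis by simp
      qed simp
    qed
    then obtain R where "inj_on R (I - {i})" "\<forall>j\<in>I - {i}. R j \<in> S j - {x}" by blast
    then have "inj_on (R(i := x)) I \<and> (\<forall>j\<in>I. (R(i := x)) j \<in> S j)"
      using x by (auto simp: inj_on_def)
    then show ?thesis by blast
  next
    case tight
    let ?U = "\<Union>(S ` J)"
    have finJ: "finite J" using tight fin finite_subset by blast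
    have "\<exists>R. inj_on R J \<and> (\<forall>j\<in>J. R j \<in> S j)"
    proof (rule less.hyps)
      show "card J < card I" using tight fin by (intro psubset_card_mono)
      show "card K \<le> card (\<Union>(S ` K))" if "K \<subseteq> J" for K
        using that tight hall by blast
    qed (use finJ finS tight in auto)
    then obtain R1 where R1: "inj_on R1 J" "\<forall>j\<in>J. R1 j \<in> S j" by blast
    have "\<exists>R. inj_on R (I - J) \<and> (\<forall>j\<in>I - J. R j \<in> S j - ?U)"
    proof (rule less.hyps)
      show "card (I - J) < card I" using tight fin by (intro psubset_card_mono) auto
      show "finite (I - J)" using fin by simp
      show "finite (S j - ?U)" if "j \<in> I - J" for j using that finS by simp
      fix K assume K: "K \<subseteq> I - J"
      let ?W = "\<Union>j\<in>K. S j - ?U"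
      have "finite K" using K fin finite_subset by blast
      \<comment> \<open>Hall's condition survives the deletion of \<open>?U\<close>: apply it to
        \<open>J \<union> K\<close> and cancel \<open>card J = card ?U\<close>.\<close>
      then have "card J + card K = card (J \<union> K)"
        using K finJ by (subst card_Un_disjoint) auto
      also have "\<dots> \<le> card (\<Union>(S ` (J \<union> K)))"
        using K tight by (intro hall) auto
      also have "\<Union>(S ` (J \<union> K)) = ?U \<union> ?W" by blast
      also have "card \<dots> \<le> card ?U + card ?W" by (rule card_Un_le)
      finally show "card K \<le> card ?W" using tight by simp
    qed
    then obtain R2 where R2: "inj_on R2 (I - J)" "\<forall>j\<in>I - J. R2 j \<in> S j - ?U" by blast
    let ?R = "\<lambda>j. if j \<in> J then R1 j else R2 j"
    \<comment> \<open>The two partial matchings cannot collide: the values of \<open>R1\<close> lie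
      in \<open>?U\<close>, those of \<open>R2\<close> outside it.\<close>
    have neq: "?R i \<noteq> ?R j" if "i \<in> I" "j \<in> I" "i \<noteq> j" for i j
    proof -
      have "R1 a \<noteq> R2 b" if "a \<in> J" "b \<in> I - J" for a b
        using R1(2) R2(2) that by fastforce
      moreover have "R1 a \<noteq> R1 b" if "a \<in> J" "b \<in> J" "a \<noteq> b" for a b
        using R1(1) that by (meson inj_onD)
      moreover have "R2 a \<noteq> R2 b" if "a \<in> I - J" "b \<in> I - J" "a \<noteq> b" for a b
        using R2(1) that by (meson inj_onD)
      ultimately show ?thesis using that by (metis DiffI)
    qed
    have "inj_on ?R I"
    proof (rule inj_onI, rule ccontr)
      fix i j assume ij: "i \<in> I" "j \<in> I" "?R i = ?R j" "i \<noteq> j"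
      from neq[OF ij(1,2,4)] ij(3) show False by contradiction
    qed
    moreover have "\<forall>j\<in>I. ?R j \<in> S j" using R1(2) R2(2) by simp
    ultimately show ?thesis by (intro exI[of _ ?R] conjI)
  qed
qed

section \<open>Balanced maps, which send each vertex to the index of its clique, and common
  transversals of two of them\<close>

definition balanced :: "'a set \<Rightarrow> 'b set \<Rightarrow> nat \<Rightarrow> ('a \<Rightarrow> 'b) \<Rightarrow> bool" where
  "balanced V A r f \<longleftrightarrow> f ` V \<subseteq> A \<and> (\<forall>a\<in>A. card {v \<in> V. f v = a} = r)"

lemma balanced_card_vimage:
  assumes "finite V" and "finite A" and "balanced V A r f" and "J \<subseteq> A"
  shows "card {v \<in> V. f v \<in> J} = card J * r"
proof -
  have "finite J" using assms finite_subset by blast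
  have "{v \<in> V. f v \<in> J} = (\<Union>a\<in>J. {v \<in> V. f v = a})" by blast
  also have "card \<dots> = (\<Sum>a\<in>J. card {v \<in> V. f v = a})"
    using \<open>finite J\<close> assms(1) by (intro card_UN_disjoint) auto
  also have "\<dots> = (\<Sum>a\<in>J. r)"
    using assms(3,4) by (intro sum.cong) (auto simp: balanced_def)
  finally show ?thesis by simp
qed

text \<open>Double counting gives Hall's condition: the \<open>card J * r\<close> vertices in the
  fibres of \<open>f\<close> over \<open>J\<close> all lie in the fibres of \<open>g\<close> over
  the neighbourhood \<open>?N\<close>, which hold only \<open>card ?N * r\<close> vertices.\<close>

lemma balanced_common_transversal:
  assumes "finite V" and "finite A" and "0 < r"
    and f: "balanced V A r f" and g: "balanced V A r g"
  shows "\<exists>T \<subseteq> V. bij_betw f T A \<and> bij_betw g T A"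
proof -
  let ?S = "\<lambda>a. g ` {v \<in> V. f v = a}"
  have "\<exists>R. inj_on R A \<and> (\<forall>a\<in>A. R a \<in> ?S a)"
  proof (rule hall_marriage)
    fix J assume "J \<subseteq> A"
    let ?N = "\<Union>(?S ` J)"
    have "?N \<subseteq> A" using g by (auto simp: balanced_def)
    have "card J * r = card {v \<in> V. f v \<in> J}"
      using balanced_card_vimage[OF assms(1,2) f \<open>J \<subseteq> A\<close>] ..
    also have "\<dots> \<le> card {v \<in> V. g v \<in> ?N}"
      using assms(1) by (intro card_mono) auto
    also have "\<dots> = card ?N * r"
      using balanced_card_vimage[OF assms(1,2) g \<open>?N \<subseteq> A\<close>] .
    finally show "card J \<le> card ?N" using \<open>0 < r\<close> by simp
  qed (use assms in auto)
  then obtain R where R: "inj_on R A" "\<forall>a\<in>A. R a \<in> ?S a" by blast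
  then have "\<forall>a\<in>A. \<exists>v. v \<in> V \<and> f v = a \<and> g v = R a" by fastforce
  then obtain t where t: "\<forall>a\<in>A. t a \<in> V \<and> f (t a) = a \<and> g (t a) = R a" by metis
  \<comment> \<open>An injective map of the finite set \<open>A\<close> into itself is onto, so the
    chosen vertices \<open>t a\<close> meet each fibre of \<open>g\<close> exactly once too.\<close>
  have "R ` A \<subseteq> A" using t g by (force simp: balanced_def)
  then have "R ` A = A" using R(1) assms(2) by (metis endo_inj_surj)
  then have "f ` t ` A = A" "g ` t ` A = A" "inj_on f (t ` A)" "inj_on g (t ` A)" "t ` A \<subseteq> V"
    using t R(1) by (force simp: image_image inj_on_def)+
  then show ?thesis by (auto simp: bij_betw_def)
qed

lemma balanced_Diff_transversal:
  assumes "finite V" and "balanced V A (Suc r) f" and "T \<subseteq> V" and "bij_betw f T A"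
  shows "balanced (V - T) A r f"
proof -
  have "card {v \<in> V - T. f v = a} = r" if "a \<in> A" for a
  proof -
    obtain t where t: "t \<in> T" "f t = a"
      using \<open>a \<in> A\<close> assms(4) unfolding bij_betw_def by blast
    have "{v \<in> V - T. f v = a} = {v \<in> V. f v = a} - {t}"
      using t assms(4) by (auto simp: bij_betw_def inj_on_def)
    moreover have "card {v \<in> V. f v = a} = Suc r"
      using that assms(2) by (simp add: balanced_def)
    ultimately show ?thesis using t assms(3) by (simp add: subset_iff)
  qed
  then show ?thesis using assms(2) by (auto simp: balanced_def)
qed

text \<open>Common transversals are peeled off one at a time; each removal takes one vertex from
  every fibre of both maps and so leaves them balanced with \<open>r\<close> lowered by one.\<close>

lemma balanced_transversal_cover:
  assumes "finite V" and "finite A"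
    and "balanced V A r f" and "balanced V A r g"
  shows "\<exists>T. (\<forall>j<r. bij_betw f (T j) A \<and> bij_betw g (T j) A) \<and> (\<Union>j<r. T j) = V"
  using assms
proof (induction r arbitrary: V)
  case 0
  \<comment> \<open>With \<open>r = 0\<close> all fibres over \<open>A\<close> are empty, yet every
    vertex is mapped into \<open>A\<close>.\<close>
  have "V = {}"
  proof (rule ccontr)
    assume "V \<noteq> {}"
    then obtain v where "v \<in> V" by blast
    then have "f v \<in> A" "v \<in> {u \<in> V. f u = f v}"
      using 0 by (auto simp: balanced_def)
    then show False using 0 by (auto simp: balanced_def card_eq_0_iff)
  qed
  then show ?case by simp
next
  case (Suc r)
  obtain T0 where T0: "T0 \<subseteq> V" "bij_betw f T0 A" "bij_betw g T0 A"
    using balanced_common_transversal[OF Suc.prems(1,2) _ Suc.prems(3,4)] by auto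
  note rest = balanced_Diff_transversal[OF Suc.prems(1,3) T0(1,2)]
    balanced_Diff_transversal[OF Suc.prems(1,4) T0(1,3)]
  obtain T where T: "\<forall>j<r. bij_betw f (T j) A \<and> bij_betw g (T j) A" "(\<Union>j<r. T j) = V - T0"
    using Suc.IH[OF finite_Diff[OF Suc.prems(1)] Suc.prems(2) rest] by blast
  have "(\<Union>j<Suc r. (T(r := T0)) j) = V"
    using T(2) T0(1) by (auto simp: lessThan_Suc)
  moreover have "\<forall>j<Suc r. bij_betw f ((T(r := T0)) j) A \<and> bij_betw g ((T(r := T0)) j) A"
    using T(1) T0 by (auto simp: less_Suc_eq)
  ultimately show ?case by blast
qed

section \<open>Small sets meeting every fibre of several balanced maps\<close>

lemma balanced_surj:
  assumes "0 < r" and "balanced V A r f"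
  shows "f ` V = A"
proof -
  have "a \<in> f ` V" if "a \<in> A" for a
  proof -
    have "card {v \<in> V. f v = a} \<noteq> 0" using assms that by (simp add: balanced_def)
    then show ?thesis by (auto simp: card_eq_0_iff)
  qed
  then show ?thesis using assms(2) by (auto simp: balanced_def)
qed

text \<open>The bound is \<open>card S\<close> \<le> (2 - 1/r) \<open>card A\<close> with the
  denominator cleared: a transversal costs \<open>card A\<close>, and the repair for
  \<open>h\<close> at most (1 - 1/r) \<open>card A\<close>.\<close>

lemma three_balanced_hitting_set:
  assumes "finite V" and "finite A" and "0 < r"
    and f: "balanced V A r f" and g: "balanced V A r g" and h: "balanced V A r h"
  shows "\<exists>S \<subseteq> V. f ` S = A \<and> g ` S = A \<and> h ` S = A \<and> r * card S + card A \<le> 2 * r * card A"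
proof -
  obtain T where T: "\<forall>j<r. bij_betw f (T j) A \<and> bij_betw g (T j) A" "(\<Union>j<r. T j) = V"
    using balanced_transversal_cover[OF assms(1,2) f g] by blast
  have hV: "h ` V = A" using balanced_surj[OF assms(3) h] .
  \<comment> \<open>Averaging: the \<open>h\<close>-images of the \<open>r\<close> transversals
    cover \<open>A\<close>, so they cannot all have fewer than \<open>card A\<close> / r
    elements.\<close>
  have "\<exists>j<r. card A \<le> r * card (h ` T j)"
  proof (rule ccontr)
    assume "\<not> ?thesis"
    then have less: "r * card (h ` T j) < card A" if "j < r" for j using that by auto
    have "A = (\<Union>j<r. h ` T j)" using T(2) hV by blast
    then have "card A \<le> (\<Sum>j<r. card (h ` T j))" by (simp add: card_UN_le)
    then have "r * card A \<le> (\<Sum>j<r. r * card (h ` T j))"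
      by (simp flip: sum_distrib_left)
    also have "\<dots> < (\<Sum>j<r. card A)"
      using less \<open>0 < r\<close> by (intro sum_strict_mono) auto
    finally show False by simp
  qed
  then obtain j where j: "j < r" "card A \<le> r * card (h ` T j)" by blast
  have TV: "T j \<subseteq> V" using T(2) j by blast
  \<comment> \<open>\<open>X\<close> has one vertex from each fibre of \<open>h\<close> that
    \<open>T j\<close> misses.\<close>
  obtain X where X: "X \<subseteq> V" "inj_on h X" "h ` X = A - h ` T j"
    using hV by (metis Diff_subset subset_image_inj)
  have hT: "h ` T j \<subseteq> A" using TV hV by blast
  have "card X = card A - card (h ` T j)"
    using X hT assms(2) by (metis card_Diff_subset card_image finite_subset)
  moreover have "card (h ` T j) \<le> card A" using hT assms(2) by (simp add: card_mono)
  moreover have "card (T j) = card A" using T(1) j by (meson bij_betw_same_card)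
  ultimately have "card (T j \<union> X) + card (h ` T j) \<le> 2 * card A"
    using card_Un_le[of "T j" X] by linarith
  then have "r * (card (T j \<union> X) + card (h ` T j)) \<le> r * (2 * card A)"
    by (rule mult_le_mono2)
  then have "r * card (T j \<union> X) + card A \<le> 2 * r * card A"
    using j(2) by (simp add: algebra_simps)
  moreover have "f ` T j = A" "g ` T j = A" using T(1) j by (auto simp: bij_betw_def)
  moreover have "f ` X \<subseteq> A" "g ` X \<subseteq> A" using X(1) f g unfolding balanced_def by blast+
  moreover have "h ` (T j \<union> X) = A" using X(3) hT by (auto simp: image_Un)
  ultimately show ?thesis using X(1) TV by (intro exI[of _ "T j \<union> X"]) (simp add: image_Un Un_absorb2)
qed

text \<open>Each pair of consecutive maps costs one common transversal, of size
  \<open>card A\<close>.\<close>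

lemma even_balanced_hitting_set:
  assumes "finite V" and "finite A" and "0 < r"
    and "\<And>i. i \<in> {1..2 * q} \<Longrightarrow> balanced V A r (c i)"
  shows "\<exists>S \<subseteq> V. (\<forall>i\<in>{1..2 * q}. c i ` S = A) \<and> card S \<le> q * card A"
  using assms(4)
proof (induction q)
  case 0
  then show ?case by (intro exI[of _ "{}"]) auto
next
  case (Suc q)
  obtain S where S: "S \<subseteq> V" "\<forall>i\<in>{1..2 * q}. c i ` S = A" "card S \<le> q * card A"
    using Suc by fastforce
  have last: "balanced V A r (c (2 * q + 1))" "balanced V A r (c (2 * q + 2))"
    using Suc.prems by auto
  obtain T where T: "T \<subseteq> V" "bij_betw (c (2 * q + 1)) T A" "bij_betw (c (2 * q + 2)) T A"
    using balanced_common_transversal[OF assms(1-3) last] by blast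
  have "c i ` (S \<union> T) = A" if i: "i \<in> {1..2 * Suc q}" for i
  proof -
    have sub: "c i ` (S \<union> T) \<subseteq> A" using Suc.prems[OF i] S(1) T(1) by (auto simp: balanced_def)
    have "i \<in> {1..2 * q} \<or> i = 2 * q + 1 \<or> i = 2 * q + 2" using i by auto
    then have "c i ` S = A \<or> c i ` T = A" using S(2) T unfolding bij_betw_def by blast
    then show ?thesis using sub by blast
  qed
  moreover have "card (S \<union> T) \<le> Suc q * card A"
    using card_Un_le[of S T] S(3) bij_betw_same_card[OF T(2)] by simp
  ultimately show ?case using S(1) T(1) by (intro exI[of _ "S \<union> T"]) auto
qed

text \<open>The first \<open>2 * q\<close> maps are paired and the last three treated together, for
  a total of (q + 2 - 1/r) \<open>card A\<close>. The form \<open>2 * q + 3\<close> covers exactly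
  the odd numbers from 3 on.\<close>

lemma odd_balanced_hitting_set:
  assumes "finite V" and "finite A" and "0 < r"
    and bal: "\<And>i. i \<in> {1..2 * q + 3} \<Longrightarrow> balanced V A r (c i)"
  shows "\<exists>S \<subseteq> V. (\<forall>i\<in>{1..2 * q + 3}. c i ` S = A) \<and>
    r * card S + card A \<le> r * (q + 2) * card A"
proof -
  obtain S where S: "S \<subseteq> V" "\<forall>i\<in>{1..2 * q}. c i ` S = A" "card S \<le> q * card A"
    using even_balanced_hitting_set[OF assms(1-3), of q c] bal by auto
  have last: "balanced V A r (c (2 * q + 1))" "balanced V A r (c (2 * q + 2))"
    "balanced V A r (c (2 * q + 3))"
    using bal by auto
  obtain T where T: "T \<subseteq> V" "c (2 * q + 1) ` T = A" "c (2 * q + 2) ` T = A"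
    "c (2 * q + 3) ` T = A" "r * card T + card A \<le> 2 * r * card A"
    using three_balanced_hitting_set[OF assms(1-3) last] by blast
  have "c i ` (S \<union> T) = A" if i: "i \<in> {1..2 * q + 3}" for i
  proof -
    have sub: "c i ` (S \<union> T) \<subseteq> A" using bal[OF i] S(1) T(1) by (auto simp: balanced_def)
    have "i \<in> {1..2 * q} \<or> i = 2 * q + 1 \<or> i = 2 * q + 2 \<or> i = 2 * q + 3" using i by auto
    then have "c i ` S = A \<or> c i ` T = A" using S(2) T by blast
    then show ?thesis using sub by blast
  qed
  moreover have "r * card (S \<union> T) + card A \<le> r * (q + 2) * card A"
  proof -
    have "r * card (S \<union> T) \<le> r * (q * card A + card T)"
      using card_Un_le[of S T] S(3) by (intro mult_le_mono2) linarith
    then show ?thesis using T(5) by (simp add: algebra_simps)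
  qed
  ultimately show ?thesis using S(1) T(1) by (intro exI[of _ "S \<union> T"]) auto
qed

section \<open>From graph factors to balanced maps\<close>

lemma disjoint_union_of_complete_colouring:
  assumes "disjoint_union_of_complete m r G"
  shows "\<exists>c. balanced (pverts G) {..<m} r c \<and>
    (\<forall>u\<in>pverts G. \<forall>v\<in>pverts G. u \<noteq> v \<longrightarrow> c u = c v \<longrightarrow> (u, v) \<in> parcs G)"
proof -
  obtain H :: "nat \<Rightarrow> 'a pair_pre_digraph" where
    comp: "\<And>j. j < m \<Longrightarrow> complete_digraph r (with_proj (H j))"
    and disj: "disjoint_family_on (\<lambda>j. pverts (H j)) {..<m}"
    and verts: "pverts G = (\<Union>j<m. pverts (H j))" and arcs: "parcs G = (\<Union>j<m. parcs (H j))"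
    using assms unfolding disjoint_union_of_complete_def by auto
  have "\<forall>v\<in>pverts G. \<exists>j<m. v \<in> pverts (H j)" using verts by auto
  then obtain c where c: "\<And>v. v \<in> pverts G \<Longrightarrow> c v < m \<and> v \<in> pverts (H (c v))" by metis
  \<comment> \<open>By disjointness \<open>c v\<close> is the only index whose component contains
    \<open>v\<close>, so the fibres of \<open>c\<close> are exactly the components, which have
    \<open>r\<close> vertices each.\<close>
  have fibre: "{v \<in> pverts G. c v = j} = pverts (H j)" if "j < m" for j
  proof -
    have "c v = j" if "v \<in> pverts (H j)" for v
    proof (rule ccontr)
      assume "c v \<noteq> j"
      moreover have "v \<in> pverts G" using that \<open>j < m\<close> verts by blast
      ultimately show False
        using disjoint_family_onD[OF disj, of "c v" j] c that \<open>j < m\<close> by fastforce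
    qed
    then show ?thesis using c that verts by auto
  qed
  have "balanced (pverts G) {..<m} r c"
    using c fibre comp by (auto simp: balanced_def complete_digraph_pair_def)
  moreover have "(u, v) \<in> parcs G"
    if "u \<in> pverts G" "v \<in> pverts G" "u \<noteq> v" "c u = c v" for u v
  proof -
    have "parcs (H (c u)) = {(x, y). x \<in> pverts (H (c u)) \<and> y \<in> pverts (H (c u)) \<and> x \<noteq> y}"
      using comp c that(1) by (auto simp: complete_digraph_pair_def)
    then have "(u, v) \<in> parcs (H (c u))" using c[OF that(1)] c[OF that(2)] that by simp
    then show ?thesis using arcs c[OF that(1)] by auto
  qed
  ultimately show ?thesis by blast
qed

lemma sim_dom_number_le:
  assumes "finite V" and "sim_dominating V k F S"
  shows "sim_dom_number V k F \<le> card S"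
proof -
  have "finite {S. sim_dominating V k F S}"
    using assms(1) by (rule finite_subset[rotated, OF finite_Pow_iff[THEN iffD2]])
      (auto simp: sim_dominating_def)
  then show ?thesis using assms(2) by (auto simp: sim_dom_number_def intro: Min_le)
qed

theorem theorem20:
  fixes r n k :: nat
    and V :: "'a set"
    and F :: "nat \<Rightarrow> 'a pair_pre_digraph"
  assumes "1 \<le> r" and "r \<le> n" and "n mod r = 0"
    and "2 \<le> k"
    and "finite V" and "card V = n"
    and "\<And>i. i \<in> {1..k} \<Longrightarrow> pair_graph (F i)"
    and "\<And>i. i \<in> {1..k} \<Longrightarrow> pverts (F i) = V"
    and "\<And>i. i \<in> {1..k} \<Longrightarrow> disjoint_union_of_complete (n div r) r (F i)"
  shows "real (sim_dom_number V k F) \<le>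
    (if even k then (real k / (2 * real r)) * real n
     else ((real r * (real k + 1) - 2) / (2 * (real r)\<^sup>2)) * real n)"
proof -
  define m where "m = n div r"
  have n: "real n = real r * real m"
    using assms(3) by (simp add: m_def mod_eq_0_iff_dvd flip: of_nat_mult)
  have r: "0 < r" "real r > 0" using assms(1) by auto
  \<comment> \<open>Every factor has \<open>m\<close> cliques, so all the maps can share the target
    \<open>{..<m}\<close>, as the hitting set lemmas require.\<close>
  have "\<forall>i\<in>{1..k}. \<exists>c. balanced V {..<m} r c \<and>
      (\<forall>u\<in>V. \<forall>v\<in>V. u \<noteq> v \<longrightarrow> c u = c v \<longrightarrow> (u, v) \<in> parcs (F i))"
    using disjoint_union_of_complete_colouring assms(8,9) unfolding m_def by metis
  then obtain c where bal: "\<And>i. i \<in> {1..k} \<Longrightarrow> balanced V {..<m} r (c i)"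
    and adj: "\<And>i u v. \<lbrakk>i \<in> {1..k}; u \<in> V; v \<in> V; u \<noteq> v; c i u = c i v\<rbrakk> \<Longrightarrow> (u, v) \<in> parcs (F i)"
    by metis
  \<comment> \<open>A vertex \<open>v\<close> outside \<open>S\<close> shares its clique in
    \<open>F i\<close> with some \<open>u\<close> in \<open>S\<close>; then
    \<open>u \<noteq> v\<close>, so the two are adjacent.\<close>
  have dom: "sim_dom_number V k F \<le> card S"
    if S: "S \<subseteq> V" "\<forall>i\<in>{1..k}. c i ` S = {..<m}" for S
  proof (rule sim_dom_number_le[OF assms(5)])
    have "\<exists>u\<in>S. (v, u) \<in> parcs (F i)" if i: "i \<in> {1..k}" and v: "v \<in> V - S" for i v
    proof -
      have "c i v \<in> c i ` S" using bal[OF i] S(2) i v by (auto simp: balanced_def)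
      then obtain u where "u \<in> S" "c i v = c i u" by blast
      then show ?thesis using adj[OF i, of v u] v S(1) by blast
    qed
    then show "sim_dominating V k F S" using S(1) by (simp add: sim_dominating_def)
  qed
  show ?thesis
  proof (cases "even k")
    case True
    then obtain q where q: "k = 2 * q" by blast
    obtain S where S: "S \<subseteq> V" "\<forall>i\<in>{1..k}. c i ` S = {..<m}" "card S \<le> q * m"
      using even_balanced_hitting_set[OF assms(5) _ r(1), of "{..<m}" q c] bal q by auto
    have "sim_dom_number V k F \<le> q * m" using dom[OF S(1,2)] S(3) by simp
    then have "real (sim_dom_number V k F) \<le> real q * real m" by (simp flip: of_nat_mult)
    also have "\<dots> = (real k / (2 * real r)) * real n" using n r q by simp
    finally show ?thesis using True by simp
  next
    case False
    \<comment> \<open>An odd \<open>k\<close> with \<open>2 \<le> k\<close> is at least 3, so the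
      subtraction does not truncate.\<close>
    define q where "q = (k - 3) div 2"
    have q: "k = 2 * q + 3" using False assms(4) unfolding q_def by presburger
    obtain S where S: "S \<subseteq> V" "\<forall>i\<in>{1..k}. c i ` S = {..<m}"
      "r * card S + m \<le> r * (q + 2) * m"
      using odd_balanced_hitting_set[OF assms(5) _ r(1), of "{..<m}" q c] bal q by auto
    have "r * sim_dom_number V k F + m \<le> r * (q + 2) * m"
      using mult_le_mono2[OF dom[OF S(1,2)], of r] S(3) by linarith
    then have "real (r * sim_dom_number V k F + m) \<le> real (r * (q + 2) * m)"
      by (rule of_nat_mono)
    then have "real r * real (sim_dom_number V k F) \<le> (real r * (real q + 2) - 1) * real m"
      by (simp add: algebra_simps)
    then have "real (sim_dom_number V k F) \<le> (real r * (real q + 2) - 1) * real m / real r"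
      using r by (simp add: field_simps)
    \<comment> \<open>Here q + 2 = (k + 1)/2 and m = n/r turn (q + 2 - 1/r) m into the stated
      bound.\<close>
    also have "\<dots> = ((real r * (real k + 1) - 2) / (2 * (real r)\<^sup>2)) * real n"
      using n r q by (simp add: field_simps power2_eq_square)
    finally show ?thesis using False by simp
  qed
qed

end
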